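(* Let $\mathbf G$ be a non-trivial integral residuated lattice, let $I_1\subseteq I_0$ be sets with $I_0$ finite, let $\lambda\colon I_1\to I_0$ be injective, and suppose that the kite $K^\lambda_{I_0,I_1}(\mathbf G)$ is subdirectly irreducible. Then $K^\lambda_{I_0,I_1}(\mathbf G)$ is isomorphic to one of the following kites: (1) (i) $K^\emptyset_{\emptyset,\emptyset}(\mathbf G)\cong\mathbf Z^-$; (ii) $K^{Id}_{\{0\},\{0\}}(\mathbf G)\cong\mathbf G\,\overleftarrow{\times}\,\mathbf Z^-$ with $\mathbf G$ subdirectly irreducible; (iii) $K^\emptyset_{\{0\},\emptyset}(\mathbf G)$ with $\mathbf G$ subdirectly irreducible. (2) $K^\lambda_{n,n}(\mathbf G)$ with $\lambda(i)=i+1\ (\mathrm{mod}\ n)$ for $i=0,\dots,n-1$, where $n\ge2$. (3) $K^\lambda_{n+1,n}(\mathbf G)$ with $\lambda(i)=i+1$ for $i=0,\dots,n-1$, where $n\ge1$.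
   Context: $\mathbb N=\{0,1,2,\dots\}$. A residuated lattice is an algebra $\mathbf G=(G;\wedge,\vee,\cdot,\backslash,/,e)$ such that $(G;\wedge,\vee)$ is a lattice, $(G;\cdot,e)$ is a monoid, and $x\cdot y\le z$ iff $y\le x\backslash z$ iff $x\le z/y$ for all $x,y,z\in G$. It is integral if $x\le e$ for all $x\in G$; it is non-trivial if $G\ne\{e\}$. A non-trivial residuated lattice is subdirectly irreducible if it has a least non-identity congruence. The kite $K^\lambda_{I_0,I_1}(\mathbf G)$ ($I_1\subseteq I_0$ sets, $\lambda\colon I_1\to I_0$ injective) is the following integral residuated lattice. For $n\ge1$ put $I_{n+1}=\{i\in I_n: \lambda(i)\in I_n\}$. Then $\lambda^{m-n}$ is a well-defined injective map $I_m\to I_n$ for $n\le m$; $\lambda^{-m}$ denotes the inverse of $\lambda^m$ on its image. The universe is the disjoint union $\biguplus_{n\in\mathbb N}G^{I_n}$ (different $n$ always give disjoint parts; if $I_n=\emptyset$, $G^{I_n}$ is a singleton), with elements written $\langle x_i: i\in I_n\rangle$. Order: $\langle x_i: i\in I_n\rangle\le\langle y_i: i\in I_m\rangle$ iff $m<n$, or $m=n$ and $x_i\le y_i$ for all $i\in I_n$. Unit: $1\in G^{I_0}$ with all coordinates $e$. Product: $\langle x_i: i\in I_m\rangle\cdot\langle y_i: i\in I_n\rangle=\langle x_{\lambda^n(i)}y_i: i\in I_{m+n}\rangle$. Right division: $\langle y_i: i\in I_n\rangle/\!/\langle x_i: i\in I_m\rangle$ is $1$ if $m>n$; if $m\le n$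 it is the element of $G^{I_{n-m}}$ with $i$-th coordinate $y_{\lambda^{-m}(i)}/x_{\lambda^{-m}(i)}$ if $i\in\lambda^m(I_n)$ and $e$ otherwise. Left division: $\langle y_i: i\in I_n\rangle\backslash\!\backslash\langle x_i: i\in I_m\rangle$ is $1$ if $n>m$; if $n\le m$ it is the element of $G^{I_{m-n}}$ with $i$-th coordinate $y_{\lambda^{m-n}(i)}\backslash x_i$ if $i\in I_m$ and $e$ otherwise. Notation: for $m,n\ge1$, $K^\lambda_{m,n}(\mathbf G)$ is $K^\lambda_{I_0,I_1}(\mathbf G)$ with $I_0=\{0,\dots,m-1\}$ and $I_1=\{0,\dots,n-1\}$. The superscript $\emptyset$ denotes the empty map, and $Id$ the identity map. $\mathbf Z^-$ is the integral residuated lattice on $\mathbb Z^-=\{0,-1,-2,\dots\}$ with its usual order, product $+$, unit $0$ and divisions $x\backslash y=y/x=\min(y-x,0)$. $\mathbf G\,\overleftarrow{\times}\,\mathbf Z^-$ (antilexicographic product) is the integral residuated lattice on $G\times\mathbb Z^-$ with order $(x,-m)\le(y,-n)$ iff $m>n$, or $m=n$ and $x\le y$ ($m,n\in\mathbb N$); product $(x,-m)\cdot(y,-n)=(xy,-(m+n))$; unit $(e,0)$; $(x,-m)\backslash(y,-n)=(x\backslash y,m-n)$ if $m\le n$ and $(e,0)$ otherwise; $(y,-n)/(x,-m)=(y/x,m-n)$ if $m\le n$ and $(e,0)$ otherwise. *)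

theory Defs
  imports "HOL-Algebra.Group"
begin

section \<open>Residuated lattices\<close>

text \<open>
  The lattice part is a lattice in the sense of \<^theory>\<open>HOL-Algebra.Lattice\<close>: the order is a record
  field, and meet and join are the library operations derived from it. In \<^locale>\<open>lattice\<close> the
  field \<open>eq\<close> is forced to be equality.
\<close>

record 'a rlat = "'a gorder" +
  rmult :: "'a \<Rightarrow> 'a \<Rightarrow> 'a" (infixl \<open>\<odot>\<index>\<close> 70)
  runit :: 'a
  ldiv :: "'a \<Rightarrow> 'a \<Rightarrow> 'a"  \<comment> \<open>\<open>ldiv G x z\<close> is \<open>x\<close> under \<open>z\<close>\<close>
  rdiv :: "'a \<Rightarrow> 'a \<Rightarrow> 'a"  \<comment> \<open>\<open>rdiv G z y\<close> is \<open>z / y\<close>\<close>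

locale residuated_lattice = lattice G +
    mon: monoid "\<lparr>carrier = carrier G, mult = rmult G, one = runit G\<rparr>"
  for G (structure) +
  assumes ldiv_closed: "\<lbrakk>x \<in> carrier G; z \<in> carrier G\<rbrakk> \<Longrightarrow> ldiv G x z \<in> carrier G"
    and rdiv_closed: "\<lbrakk>z \<in> carrier G; y \<in> carrier G\<rbrakk> \<Longrightarrow> rdiv G z y \<in> carrier G"
    and ldiv_adjoint: "\<lbrakk>x \<in> carrier G; y \<in> carrier G; z \<in> carrier G\<rbrakk>
      \<Longrightarrow> x \<odot> y \<sqsubseteq> z \<longleftrightarrow> y \<sqsubseteq> ldiv G x z"
    and rdiv_adjoint: "\<lbrakk>x \<in> carrier G; y \<in> carrier G; z \<in> carrier G\<rbrakk>
      \<Longrightarrow> x \<odot> y \<sqsubseteq> z \<longleftrightarrow> x \<sqsubseteq> rdiv G z y"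

locale integral_residuated_lattice = residuated_lattice +
  assumes integral: "x \<in> carrier G \<Longrightarrow> x \<sqsubseteq> runit G"

definition nontrivial_rlat :: "'a rlat \<Rightarrow> bool" where
  "nontrivial_rlat G \<longleftrightarrow> carrier G \<noteq> {runit G}"

definition compatible_op :: "('a \<times> 'a) set \<Rightarrow> ('a \<Rightarrow> 'a \<Rightarrow> 'a) \<Rightarrow> bool" where
  "compatible_op \<theta> f \<longleftrightarrow>
    (\<forall>x x' y y'. (x, x') \<in> \<theta> \<longrightarrow> (y, y') \<in> \<theta> \<longrightarrow> (f x y, f x' y') \<in> \<theta>)"

definition rlat_congruence :: "'a rlat \<Rightarrow> ('a \<times> 'a) set \<Rightarrow> bool" where
  "rlat_congruence G \<theta> \<longleftrightarrow> equiv (carrier G) \<theta> \<and>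
    compatible_op \<theta> (meet G) \<and> compatible_op \<theta> (join G) \<and> compatible_op \<theta> (rmult G) \<and>
    compatible_op \<theta> (ldiv G) \<and> compatible_op \<theta> (rdiv G)"

definition subdirectly_irreducible :: "'a rlat \<Rightarrow> bool" where
  "subdirectly_irreducible G \<longleftrightarrow> nontrivial_rlat G \<and>
    (\<exists>\<mu>. rlat_congruence G \<mu> \<and> \<mu> \<noteq> Id_on (carrier G) \<and>
       (\<forall>\<theta>. rlat_congruence G \<theta> \<and> \<theta> \<noteq> Id_on (carrier G) \<longrightarrow> \<mu> \<subseteq> \<theta>))"

definition preserves_op ::
    "('a \<Rightarrow> 'b) \<Rightarrow> 'a set \<Rightarrow> ('a \<Rightarrow> 'a \<Rightarrow> 'a) \<Rightarrow> ('b \<Rightarrow> 'b \<Rightarrow> 'b) \<Rightarrow> bool" where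
  "preserves_op h A f g \<longleftrightarrow> (\<forall>x\<in>A. \<forall>y\<in>A. h (f x y) = g (h x) (h y))"

definition rlat_iso :: "'a rlat \<Rightarrow> 'b rlat \<Rightarrow> bool" (infix \<open>\<cong>\<^sub>R\<close> 60) where
  "A \<cong>\<^sub>R B \<longleftrightarrow> (\<exists>h. bij_betw h (carrier A) (carrier B) \<and>
    preserves_op h (carrier A) (meet A) (meet B) \<and>
    preserves_op h (carrier A) (join A) (join B) \<and>
    preserves_op h (carrier A) (rmult A) (rmult B) \<and>
    preserves_op h (carrier A) (ldiv A) (ldiv B) \<and>
    preserves_op h (carrier A) (rdiv A) (rdiv B) \<and>
    h (runit A) = runit B)"


section \<open>Kites\<close>

text \<open>
  The map from \<open>I\<^sub>1\<close> to \<open>I\<^sub>0\<close> is a total function of which only the values on \<open>I\<^sub>1\<close> are used.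
  An element of \<open>G\<close> to the power \<open>I\<^sub>n\<close> is a pair \<open>(n, x)\<close> with \<open>x\<close> extensional on \<open>I\<^sub>n\<close>;
  the tag \<open>n\<close> makes the union disjoint.
\<close>

fun kite_index :: "'i set \<Rightarrow> 'i set \<Rightarrow> ('i \<Rightarrow> 'i) \<Rightarrow> nat \<Rightarrow> 'i set" where
  "kite_index I0 I1 l 0 = I0"
| "kite_index I0 I1 l (Suc 0) = I1"
| "kite_index I0 I1 l (Suc (Suc n)) =
    {i \<in> kite_index I0 I1 l (Suc n). l i \<in> kite_index I0 I1 l (Suc n)}"

definition kite_carrier ::
    "'i set \<Rightarrow> 'i set \<Rightarrow> ('i \<Rightarrow> 'i) \<Rightarrow> 'a rlat \<Rightarrow> (nat \<times> ('i \<Rightarrow> 'a)) set" where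
  "kite_carrier I0 I1 l G = (SIGMA n:UNIV. kite_index I0 I1 l n \<rightarrow>\<^sub>E carrier G)"

fun kite_le ::
    "'i set \<Rightarrow> 'i set \<Rightarrow> ('i \<Rightarrow> 'i) \<Rightarrow> 'a rlat \<Rightarrow>
      nat \<times> ('i \<Rightarrow> 'a) \<Rightarrow> nat \<times> ('i \<Rightarrow> 'a) \<Rightarrow> bool" where
  "kite_le I0 I1 l G (n, x) (m, y) \<longleftrightarrow>
    m < n \<or> (m = n \<and> (\<forall>i\<in>kite_index I0 I1 l n. x i \<sqsubseteq>\<^bsub>G\<^esub> y i))"

definition kite_unit ::
    "'i set \<Rightarrow> 'i set \<Rightarrow> ('i \<Rightarrow> 'i) \<Rightarrow> 'a rlat \<Rightarrow> nat \<times> ('i \<Rightarrow> 'a)" where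
  "kite_unit I0 I1 l G = (0, \<lambda>i\<in>kite_index I0 I1 l 0. runit G)"

fun kite_mult ::
    "'i set \<Rightarrow> 'i set \<Rightarrow> ('i \<Rightarrow> 'i) \<Rightarrow> 'a rlat \<Rightarrow>
      nat \<times> ('i \<Rightarrow> 'a) \<Rightarrow> nat \<times> ('i \<Rightarrow> 'a) \<Rightarrow> nat \<times> ('i \<Rightarrow> 'a)" where
  "kite_mult I0 I1 l G (m, x) (n, y) =
    (m + n, \<lambda>i\<in>kite_index I0 I1 l (m + n). x ((l ^^ n) i) \<odot>\<^bsub>G\<^esub> y i)"

fun kite_rdiv ::
    "'i set \<Rightarrow> 'i set \<Rightarrow> ('i \<Rightarrow> 'i) \<Rightarrow> 'a rlat \<Rightarrow>
      nat \<times> ('i \<Rightarrow> 'a) \<Rightarrow> nat \<times> ('i \<Rightarrow> 'a) \<Rightarrow> nat \<times> ('i \<Rightarrow> 'a)" where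
  "kite_rdiv I0 I1 l G (n, y) (m, x) =
    (if m > n then kite_unit I0 I1 l G
     else (n - m, \<lambda>i\<in>kite_index I0 I1 l (n - m).
       if i \<in> (l ^^ m) ` kite_index I0 I1 l n
       then rdiv G (y (inv_into (kite_index I0 I1 l m) (l ^^ m) i))
                   (x (inv_into (kite_index I0 I1 l m) (l ^^ m) i))
       else runit G))"

fun kite_ldiv ::
    "'i set \<Rightarrow> 'i set \<Rightarrow> ('i \<Rightarrow> 'i) \<Rightarrow> 'a rlat \<Rightarrow>
      nat \<times> ('i \<Rightarrow> 'a) \<Rightarrow> nat \<times> ('i \<Rightarrow> 'a) \<Rightarrow> nat \<times> ('i \<Rightarrow> 'a)" where
  "kite_ldiv I0 I1 l G (n, y) (m, x) =
    (if n > m then kite_unit I0 I1 l G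
     else (m - n, \<lambda>i\<in>kite_index I0 I1 l (m - n).
       if i \<in> kite_index I0 I1 l m then ldiv G (y ((l ^^ (m - n)) i)) (x i) else runit G))"

definition kite ::
    "'i set \<Rightarrow> 'i set \<Rightarrow> ('i \<Rightarrow> 'i) \<Rightarrow> 'a rlat \<Rightarrow> (nat \<times> ('i \<Rightarrow> 'a)) rlat" where
  "kite I0 I1 l G = \<lparr>
     carrier = kite_carrier I0 I1 l G,
     eq = (=),
     le = kite_le I0 I1 l G,
     rmult = kite_mult I0 I1 l G,
     runit = kite_unit I0 I1 l G,
     ldiv = kite_ldiv I0 I1 l G,
     rdiv = kite_rdiv I0 I1 l G\<rparr>"

abbreviation fin_kite ::
    "nat \<Rightarrow> nat \<Rightarrow> (nat \<Rightarrow> nat) \<Rightarrow> 'a rlat \<Rightarrow> (nat \<times> (nat \<Rightarrow> 'a)) rlat" where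
  "fin_kite m n l G \<equiv> kite {0..<m} {0..<n} l G"

text \<open>The empty map; for empty \<open>I\<^sub>1\<close> none of its values is ever used.\<close>

abbreviation empty_map :: "'i \<Rightarrow> 'i" where
  "empty_map \<equiv> (\<lambda>_. undefined)"


section \<open>The negative integers and the antilexicographic product\<close>

definition Z_minus :: "int rlat" where
  "Z_minus = \<lparr>
     carrier = {..0},
     eq = (=),
     le = (\<le>),
     rmult = (+),
     runit = 0,
     ldiv = (\<lambda>x y. min (y - x) 0),
     rdiv = (\<lambda>y x. min (y - x) 0)\<rparr>"

text \<open>
  The second components below are nonpositive integers \<open>a = -m\<close> and \<open>b = -n\<close>, so that
  \<open>m \<le> n\<close> reads \<open>b \<le> a\<close> and \<open>m - n\<close> reads \<open>b - a\<close>.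
\<close>

definition antilex_Z_minus :: "'a rlat \<Rightarrow> ('a \<times> int) rlat" where
  "antilex_Z_minus G = \<lparr>
     carrier = carrier G \<times> {..0},
     eq = (=),
     le = (\<lambda>(x, a) (y, b). a < b \<or> (a = b \<and> x \<sqsubseteq>\<^bsub>G\<^esub> y)),
     rmult = (\<lambda>(x, a) (y, b). (x \<odot>\<^bsub>G\<^esub> y, a + b)),
     runit = (runit G, 0),
     ldiv = (\<lambda>(x, a) (y, b). if b \<le> a then (ldiv G x y, b - a) else (runit G, 0)),
     rdiv = (\<lambda>(y, b) (x, a). if b \<le> a then (rdiv G y x, b - a) else (runit G, 0))\<rparr>"

end

theory Submission
  imports Defs
begin

text \<open>
  View \<open>\<lambda>\<close> as a directed graph on \<open>I\<^sub>0\<close> with an edge from \<open>i\<close> to \<open>\<lambda>(i)\<close> for each \<open>i \<in> I\<^sub>1\<close>.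
  In every operation of the kite the coordinate \<open>i\<close> of the result is computed from coordinates
  of the arguments that lie in the connected component of \<open>i\<close>. Hence, if \<open>J\<close> is a union of connected
  components, agreement on the coordinates in \<open>J\<close> is a congruence of the kite. If \<open>J\<close> is
  neither empty nor all of \<open>I\<^sub>0\<close>, then \<open>J\<close> and its complement give two congruences that meet in
  the identity, and neither of them is the identity because \<open>\<^bold>G\<close> is non-trivial; this excludes a
  least non-identity congruence. So subdirect irreducibility makes the graph connected
  (\<open>subdirectly_irreducible_connected\<close>).

  An injective partial map on a finite set whose graph is connected is a single cycle or a
  single path (\<open>connected_cycle_or_path\<close>), and kites depend on their index data only up to
  renaming (\<open>relabel_iso\<close>). This leaves the empty graph, the cycles and the paths. The cycle and
  the path with one vertex are the two cases in which \<open>\<^bold>G\<close> itself must be subdirectly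
  irreducible: a congruence of \<open>\<^bold>G\<close> lifts coordinatewise to the kite, and the least congruence of
  the kite restricts to \<open>\<^bold>G\<close>, which is the part of the kite at level \<open>0\<close>
  (\<open>subdirectly_irreducible_base\<close>).
\<close>


section \<open>Order isomorphisms and pullbacks of congruences\<close>

lemma is_glb_pair_iff:
  "\<lbrakk>x \<in> carrier L; y \<in> carrier L\<rbrakk> \<Longrightarrow> is_glb L m {x, y} \<longleftrightarrow>
    m \<in> carrier L \<and> le L m x \<and> le L m y \<and> (\<forall>z\<in>carrier L. le L z x \<and> le L z y \<longrightarrow> le L z m)"
  unfolding greatest_def Lower_def by blast

lemma is_lub_pair_iff:
  "\<lbrakk>x \<in> carrier L; y \<in> carrier L\<rbrakk> \<Longrightarrow> is_lub L m {x, y} \<longleftrightarrow>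
    m \<in> carrier L \<and> le L x m \<and> le L y m \<and> (\<forall>z\<in>carrier L. le L x z \<and> le L y z \<longrightarrow> le L m z)"
  unfolding least_def Upper_def by blast

text \<open>
  Meets and joins are Hilbert choices of a bound, so antisymmetry is what identifies them.
\<close>

lemma meet_eqI:
  assumes "\<And>a b. \<lbrakk>a \<in> carrier L; b \<in> carrier L; le L a b; le L b a\<rbrakk> \<Longrightarrow> a = b"
    and "is_glb L m {x, y}"
  shows "meet L x y = m"
  unfolding meet_def inf_def
proof (rule some_equality)
  show "is_glb L m {x, y}" by fact
  fix m' assume "is_glb L m' {x, y}"
  then show "m' = m" using assms unfolding greatest_def
    by (meson in_mono)
qed

lemma join_eqI:
  assumes "\<And>a b. \<lbrakk>a \<in> carrier L; b \<in> carrier L; le L a b; le L b a\<rbrakk> \<Longrightarrow> a = b"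
    and "is_lub L m {x, y}"
  shows "join L x y = m"
  unfolding join_def sup_def
proof (rule some_equality)
  show "is_lub L m {x, y}" by fact
  fix m' assume "is_lub L m' {x, y}"
  then show "m' = m" using assms unfolding least_def
    by (meson in_mono)
qed

lemma (in lattice) antisym:
  "\<lbrakk>a \<in> carrier L; b \<in> carrier L; a \<sqsubseteq> b; b \<sqsubseteq> a\<rbrakk> \<Longrightarrow> a = b"
  using weak_le_antisym eq_is_equal by auto

text \<open>
  Meets and joins are determined by the order, so an order isomorphism transports them together
  with their existence.
\<close>

lemma (in lattice) order_iso_preserves_meet_join:
  assumes bij: "bij_betw h (carrier L) (carrier B)"
    and le: "\<And>x y. \<lbrakk>x \<in> carrier L; y \<in> carrier L\<rbrakk> \<Longrightarrow> le B (h x) (h y) \<longleftrightarrow> x \<sqsubseteq> y"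
  shows "preserves_op h (carrier L) (meet L) (meet B)"
    and "preserves_op h (carrier L) (join L) (join B)"
proof -
  have B: "carrier B = h ` carrier L"
    using bij by (simp add: bij_betw_imp_surj_on)
  have anti: "a = b" if "a \<in> carrier B" "b \<in> carrier B" "le B a b" "le B b a" for a b
    using that le antisym unfolding B by blast
  show "preserves_op h (carrier L) (meet L) (meet B)"
    unfolding preserves_op_def
  proof (intro ballI)
    fix x y assume xy: "x \<in> carrier L" "y \<in> carrier L"
    have "is_glb B (h (x \<sqinter> y)) {h x, h y}"
      using xy by (auto simp: is_glb_pair_iff B le meet_left meet_right intro: meet_le)
    from meet_eqI[OF anti this] show "h (x \<sqinter> y) = h x \<sqinter>\<^bsub>B\<^esub> h y" by simp
  qed
  show "preserves_op h (carrier L) (join L) (join B)"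
    unfolding preserves_op_def
  proof (intro ballI)
    fix x y assume xy: "x \<in> carrier L" "y \<in> carrier L"
    have "is_lub B (h (x \<squnion> y)) {h x, h y}"
      using xy by (auto simp: is_lub_pair_iff B le join_left join_right intro: join_le)
    from join_eqI[OF anti this] show "h (x \<squnion> y) = h x \<squnion>\<^bsub>B\<^esub> h y" by simp
  qed
qed

lemma rlat_isoI:
  assumes "lattice A" and "bij_betw h (carrier A) (carrier B)"
    and "\<And>x y. \<lbrakk>x \<in> carrier A; y \<in> carrier A\<rbrakk> \<Longrightarrow> le B (h x) (h y) \<longleftrightarrow> le A x y"
    and "\<And>x y. \<lbrakk>x \<in> carrier A; y \<in> carrier A\<rbrakk> \<Longrightarrow> h (rmult A x y) = rmult B (h x) (h y)"
    and "\<And>x y. \<lbrakk>x \<in> carrier A; y \<in> carrier A\<rbrakk> \<Longrightarrow> h (ldiv A x y) = ldiv B (h x) (h y)"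
    and "\<And>x y. \<lbrakk>x \<in> carrier A; y \<in> carrier A\<rbrakk> \<Longrightarrow> h (rdiv A x y) = rdiv B (h x) (h y)"
    and "h (runit A) = runit B"
  shows "A \<cong>\<^sub>R B"
  unfolding rlat_iso_def
  using lattice.order_iso_preserves_meet_join[OF assms(1,2,3)] assms
  by (intro exI[of _ h]) (simp add: preserves_op_def)

lemma compatible_op_pullback:
  assumes "compatible_op \<theta> g" and "preserves_op h A f g"
    and "\<And>x y. \<lbrakk>x \<in> A; y \<in> A\<rbrakk> \<Longrightarrow> f x y \<in> A"
  shows "compatible_op {(a, b). a \<in> A \<and> b \<in> A \<and> (h a, h b) \<in> \<theta>} f"
  using assms unfolding compatible_op_def preserves_op_def by auto

context residuated_lattice
begin

lemma rmult_closed [simp]: "\<lbrakk>x \<in> carrier G; y \<in> carrier G\<rbrakk> \<Longrightarrow> x \<odot> y \<in> carrier G"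
  using mon.m_closed by simp

lemma runit_closed [simp]: "runit G \<in> carrier G"
  using mon.one_closed by simp

end

text \<open>
  This is how a congruence of a kite is restricted to the copy of \<open>\<^bold>G\<close> inside it.
\<close>

lemma congruence_pullback:
  fixes G :: "'a rlat" and B :: "'b rlat"
  assumes "residuated_lattice G" and "rlat_congruence B \<theta>"
    and sub: "h ` carrier G \<subseteq> carrier B"
    and "preserves_op h (carrier G) (meet G) (meet B)"
    and "preserves_op h (carrier G) (join G) (join B)"
    and "preserves_op h (carrier G) (rmult G) (rmult B)"
    and "preserves_op h (carrier G) (ldiv G) (ldiv B)"
    and "preserves_op h (carrier G) (rdiv G) (rdiv B)"
  shows "rlat_congruence G {(a, b). a \<in> carrier G \<and> b \<in> carrier G \<and> (h a, h b) \<in> \<theta>}"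
proof -
  interpret residuated_lattice G by fact
  let ?\<nu> = "{(a, b). a \<in> carrier G \<and> b \<in> carrier G \<and> (h a, h b) \<in> \<theta>}"
  have "equiv (carrier B) \<theta>" using assms(2) by (simp add: rlat_congruence_def)
  then have "equiv (carrier G) ?\<nu>"
    using sub by (auto elim!: equivE intro!: equivI refl_onI symI transI dest: symD transD refl_onD)
  then show ?thesis
    using assms(2-) unfolding rlat_congruence_def
    by (simp add: ldiv_closed rdiv_closed compatible_op_pullback[where g = "meet B"]
      compatible_op_pullback[where g = "join B"] compatible_op_pullback[where g = "rmult B"]
      compatible_op_pullback[where g = "ldiv B"] compatible_op_pullback[where g = "rdiv B"])
qed

lemma equiv_ne_Id_onE:
  assumes "equiv A \<theta>" and "\<theta> \<noteq> Id_on A"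
  obtains a b where "(a, b) \<in> \<theta>" "a \<in> A" "b \<in> A" "a \<noteq> b"
proof -
  have "\<theta> \<subseteq> A \<times> A" "Id_on A \<subseteq> \<theta>"
    using assms(1) by (auto elim!: equivE dest: refl_onD)
  then have "\<not> \<theta> \<subseteq> Id" using assms(2) by blast
  then show thesis using \<open>\<theta> \<subseteq> A \<times> A\<close> that by blast
qed

lemma Id_on_congruence:
  fixes G :: "'a rlat"
  assumes "residuated_lattice G"
  shows "rlat_congruence G (Id_on (carrier G))"
proof -
  interpret residuated_lattice G by fact
  have "equiv (carrier G) (Id_on (carrier G))"
    by (auto intro!: equivI refl_onI symI transI)
  then show ?thesis
    by (auto simp: rlat_congruence_def compatible_op_def ldiv_closed rdiv_closed)
qed

lemma total_congruence:
  fixes G :: "'a rlat"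
  assumes "residuated_lattice G"
  shows "rlat_congruence G (carrier G \<times> carrier G)"
proof -
  interpret residuated_lattice G by fact
  have "equiv (carrier G) (carrier G \<times> carrier G)"
    by (auto intro!: equivI refl_onI symI transI)
  then show ?thesis
    by (auto simp: rlat_congruence_def compatible_op_def ldiv_closed rdiv_closed)
qed

text \<open>
  Division turns the order into equality with the unit; it carries a pair of elements at any
  level of a kite to a pair at level \<open>0\<close>, where the unit lives.
\<close>

lemma (in integral_residuated_lattice) ldiv_eq_unit_iff:
  assumes "a \<in> carrier G" "b \<in> carrier G"
  shows "ldiv G a b = runit G \<longleftrightarrow> a \<sqsubseteq> b"
proof -
  have "runit G \<sqsubseteq> ldiv G a b \<longleftrightarrow> a \<sqsubseteq> b"
    using ldiv_adjoint[of a "runit G" b] mon.r_one[of a] assms by simp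
  then show ?thesis
    using antisym[of "ldiv G a b" "runit G"] integral ldiv_closed assms
    by auto
qed


lemma inv_into_id_singleton: "inv_into {i} id i = i"
  using inv_into_f_f[of id "{i}" i] by simp


section \<open>The index sets of a kite\<close>

locale kite_indices =
  fixes I0 I1 :: "'i set" and l :: "'i \<Rightarrow> 'i"
  assumes I1_subset: "I1 \<subseteq> I0" and l_closed: "l ` I1 \<subseteq> I0" and l_inj: "inj_on l I1"
begin

abbreviation I :: "nat \<Rightarrow> 'i set" where
  "I \<equiv> kite_index I0 I1 l"

text \<open>
  \<open>I\<^sub>n\<close> is the domain of the partial map \<open>\<lambda>\<^sup>n\<close>: the recursion asks that both \<open>i\<close> and
  \<open>\<lambda>(i)\<close> allow one step less, so \<open>\<lambda>\<close> may be applied \<open>n\<close> times in a row.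
\<close>

lemma mem_index_iff: "i \<in> I n \<longleftrightarrow> i \<in> I0 \<and> (\<forall>k<n. (l ^^ k) i \<in> I1)"
proof (induction n arbitrary: i rule: induct_nat_012)
  case 1
  then show ?case using I1_subset by auto
next
  case (ge2 n)
  have l0: "i \<in> I1 \<Longrightarrow> l i \<in> I0" using l_closed by blast
  have shift: "(l ^^ k) (l i) = (l ^^ Suc k) i" for k by (simp add: funpow_swap1)
  have "i \<in> I (Suc (Suc n)) \<longleftrightarrow>
      i \<in> I0 \<and> (\<forall>k<Suc n. (l ^^ k) i \<in> I1) \<and> l i \<in> I0 \<and> (\<forall>k<Suc n. (l ^^ Suc k) i \<in> I1)"
    using ge2.IH by (simp add: shift del: funpow.simps)
  also have "\<dots> \<longleftrightarrow> i \<in> I0 \<and> (\<forall>k<Suc (Suc n). (l ^^ k) i \<in> I1)"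
    using l0 zero_less_Suc[of n] All_less_Suc[of "Suc n" "\<lambda>k. (l ^^ k) i \<in> I1"]
      All_less_Suc2[of "Suc n" "\<lambda>k. (l ^^ k) i \<in> I1"] by (metis funpow_0)
  finally show ?case .
qed simp

lemma index_subset: "I n \<subseteq> I0"
  by (auto simp: mem_index_iff)

lemma index_antimono: "m \<le> n \<Longrightarrow> I n \<subseteq> I m"
  by (auto simp: mem_index_iff)

lemma mem_index_Suc_iff: "i \<in> I (Suc n) \<longleftrightarrow> i \<in> I n \<and> (l ^^ n) i \<in> I1"
  by (auto simp: mem_index_iff less_Suc_eq)

lemma funpow_mem_I0: "i \<in> I n \<Longrightarrow> (l ^^ n) i \<in> I0"
  using l_closed by (cases n) (auto simp: mem_index_iff)

text \<open>
  Applying \<open>\<lambda>\<close> \<open>m + n\<close> times is applying it \<open>n\<close> times and then \<open>m\<close> times. Well-definedness of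
  the product and of both divisions rests on this.
\<close>

lemma mem_index_add_iff: "i \<in> I (m + n) \<longleftrightarrow> i \<in> I n \<and> (l ^^ n) i \<in> I m"
proof (induction m)
  case 0
  then show ?case using funpow_mem_I0 by auto
next
  case (Suc m)
  have "(l ^^ m) ((l ^^ n) i) = (l ^^ (m + n)) i" by (simp add: funpow_add)
  with Suc show ?case by (auto simp: mem_index_Suc_iff)
qed

text \<open>Unions of connected components: closed under \<open>\<lambda>\<close> and under taking preimages.\<close>

definition invariant :: "'i set \<Rightarrow> bool" where
  "invariant J \<longleftrightarrow> (\<forall>i\<in>I1. l i \<in> J \<longleftrightarrow> i \<in> J)"

lemma invariant_funpow:
  assumes "invariant J" "i \<in> I n"
  shows "(l ^^ n) i \<in> J \<longleftrightarrow> i \<in> J"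
  using assms(2)
proof (induction n)
  case (Suc n)
  then show ?case using assms(1) by (auto simp: mem_index_Suc_iff invariant_def)
qed simp

lemma funpow_inj_on: "inj_on (l ^^ n) (I n)"
proof (induction n)
  case (Suc n)
  show ?case
  proof (rule inj_onI)
    fix i j assume ij: "i \<in> I (Suc n)" "j \<in> I (Suc n)" "(l ^^ Suc n) i = (l ^^ Suc n) j"
    then have "(l ^^ n) i = (l ^^ n) j"
      using l_inj by (auto simp: mem_index_Suc_iff dest: inj_onD)
    with Suc.IH ij show "i = j" by (auto simp: mem_index_Suc_iff dest: inj_onD)
  qed
qed simp

lemma inv_funpow [simp]:
  assumes "m \<le> n" "i \<in> I n"
  shows "inv_into (I m) (l ^^ m) ((l ^^ m) i) = i"
  using assms index_antimono funpow_inj_on by (intro inv_into_f_f) auto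

end


section \<open>Kites are lattices\<close>

locale kite_algebra = kite_indices I0 I1 l + integral_residuated_lattice G
  for I0 I1 :: "'i set" and l :: "'i \<Rightarrow> 'i" and G :: "'a rlat" (structure)
begin

abbreviation K :: "(nat \<times> ('i \<Rightarrow> 'a)) rlat" where
  "K \<equiv> kite I0 I1 l G"

lemma kite_simps [simp]:
  "eq K = (=)" "le K = kite_le I0 I1 l G" "rmult K = kite_mult I0 I1 l G"
  "runit K = kite_unit I0 I1 l G" "ldiv K = kite_ldiv I0 I1 l G" "rdiv K = kite_rdiv I0 I1 l G"
  by (simp_all add: kite_def)

lemma kite_mem_iff [simp]: "(n, x) \<in> carrier K \<longleftrightarrow> x \<in> I n \<rightarrow>\<^sub>E carrier G"
  by (simp add: kite_def kite_carrier_def)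

lemma kite_eq_iff:
  assumes "(n, x) \<in> carrier K" "(n, y) \<in> carrier K"
  shows "x = y \<longleftrightarrow> (\<forall>i\<in>I n. x i = y i)"
  using assms by (auto intro: PiE_ext)

definition kite_meet :: "nat \<times> ('i \<Rightarrow> 'a) \<Rightarrow> nat \<times> ('i \<Rightarrow> 'a) \<Rightarrow> nat \<times> ('i \<Rightarrow> 'a)" where
  "kite_meet = (\<lambda>(m, x) (n, y). if m < n then (n, y) else if n < m then (m, x)
     else (n, \<lambda>i\<in>I n. x i \<sqinter> y i))"

definition kite_join :: "nat \<times> ('i \<Rightarrow> 'a) \<Rightarrow> nat \<times> ('i \<Rightarrow> 'a) \<Rightarrow> nat \<times> ('i \<Rightarrow> 'a)" where
  "kite_join = (\<lambda>(m, x) (n, y). if m < n then (m, x) else if n < m then (n, y)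
     else (n, \<lambda>i\<in>I n. x i \<squnion> y i))"

lemma kite_antisym:
  assumes "a \<in> carrier K" "b \<in> carrier K" "le K a b" "le K b a"
  shows "a = b"
proof (cases a; cases b)
  fix m x n y assume "a = (m, x)" "b = (n, y)"
  with assms have *: "m = n" "\<forall>i\<in>I n. x i \<sqsubseteq> y i \<and> y i \<sqsubseteq> x i"
      "x \<in> I n \<rightarrow>\<^sub>E carrier G" "y \<in> I n \<rightarrow>\<^sub>E carrier G"
    by auto
  then have "x = y" by (intro PiE_ext) (auto intro!: antisym)
  with \<open>a = _\<close> \<open>b = _\<close> * show ?thesis by simp
qed

lemma kite_glb:
  assumes "a \<in> carrier K" "b \<in> carrier K"
  shows "is_glb K (kite_meet a b) {a, b}"
proof -
  obtain m x n y where ab: "a = (m, x)" "b = (n, y)" by (cases a; cases b)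
  with assms have x: "\<And>i. i \<in> I m \<Longrightarrow> x i \<in> carrier G" and y: "\<And>i. i \<in> I n \<Longrightarrow> y i \<in> carrier G"
    by (auto simp: PiE_iff)
  consider "m < n" | "n < m" | "m = n" by linarith
  then show ?thesis
    unfolding is_glb_pair_iff[OF assms]
    using assms x y
    by (cases; simp add: ab kite_meet_def meet_left meet_right PiE_iff Ball_def; auto intro!: meet_le)
qed

lemma kite_lub:
  assumes "a \<in> carrier K" "b \<in> carrier K"
  shows "is_lub K (kite_join a b) {a, b}"
proof -
  obtain m x n y where ab: "a = (m, x)" "b = (n, y)" by (cases a; cases b)
  with assms have x: "\<And>i. i \<in> I m \<Longrightarrow> x i \<in> carrier G" and y: "\<And>i. i \<in> I n \<Longrightarrow> y i \<in> carrier G"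
    by (auto simp: PiE_iff)
  consider "m < n" | "n < m" | "m = n" by linarith
  then show ?thesis
    unfolding is_lub_pair_iff[OF assms]
    using assms x y
    by (cases; simp add: ab kite_join_def join_left join_right PiE_iff Ball_def; auto intro!: join_le)
qed

lemma kite_meet_eq: "\<lbrakk>a \<in> carrier K; b \<in> carrier K\<rbrakk> \<Longrightarrow> meet K a b = kite_meet a b"
  using meet_eqI[OF kite_antisym kite_glb] .

lemma kite_join_eq: "\<lbrakk>a \<in> carrier K; b \<in> carrier K\<rbrakk> \<Longrightarrow> join K a b = kite_join a b"
  using join_eqI[OF kite_antisym kite_lub] .

lemma kite_lattice: "lattice K"
proof
  show "le K a c" if "le K a b" "le K b c" "a \<in> carrier K" "b \<in> carrier K" "c \<in> carrier K" for a b c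
    using that by (cases a; cases b; cases c) (auto simp: PiE_iff; meson le_trans)
  show "\<exists>s. is_lub K s {a, b}" if "a \<in> carrier K" "b \<in> carrier K" for a b
    using kite_lub[OF that] by blast
  show "\<exists>s. is_glb K s {a, b}" if "a \<in> carrier K" "b \<in> carrier K" for a b
    using kite_glb[OF that] by blast
  show "a .=\<^bsub>K\<^esub> b" if "le K a b" "le K b a" "a \<in> carrier K" "b \<in> carrier K" for a b
    using kite_antisym that by simp
qed (auto simp: PiE_iff)


section \<open>Coordinatewise congruences\<close>

text \<open>
  For \<open>\<theta>\<close> the identity this is agreement on \<open>J\<close>; for \<open>J\<close> everything it is the lift of
  \<open>\<theta>\<close> to the kite. Elements of different levels are never related.
\<close>

definition kite_cong :: "'i set \<Rightarrow> ('a \<times> 'a) set \<Rightarrow> ((nat \<times> ('i \<Rightarrow> 'a)) \<times> (nat \<times> ('i \<Rightarrow> 'a))) set" where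
  "kite_cong J \<theta> = {((n, x), (m, y)). (n, x) \<in> carrier K \<and> (m, y) \<in> carrier K \<and> n = m \<and>
     (\<forall>i\<in>I n \<inter> J. (x i, y i) \<in> \<theta>)}"

lemma kite_mult_closed:
  "\<lbrakk>a \<in> carrier K; b \<in> carrier K\<rbrakk> \<Longrightarrow> rmult K a b \<in> carrier K"
  by (cases a; cases b) (auto simp: PiE_iff mem_index_add_iff)

lemma kite_unit_closed: "runit K \<in> carrier K"
  by (auto simp: kite_unit_def)

lemma kite_ldiv_closed:
  assumes "a \<in> carrier K" "b \<in> carrier K"
  shows "ldiv K a b \<in> carrier K"
proof -
  obtain n y m x where ab: "a = (n, y)" "b = (m, x)" by (cases a; cases b)
  have "(l ^^ (m - n)) i \<in> I n" if "n \<le> m" "i \<in> I m" for i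
    using mem_index_add_iff[of i n "m - n"] that by simp
  with assms show ?thesis
    using kite_unit_closed by (auto simp: ab PiE_iff ldiv_closed)
qed

lemma kite_rdiv_closed:
  assumes "a \<in> carrier K" "b \<in> carrier K"
  shows "rdiv K a b \<in> carrier K"
proof -
  obtain n y m x where ab: "a = (n, y)" "b = (m, x)" by (cases a; cases b)
  have "i \<in> I m" if "m \<le> n" "i \<in> I n" for i
    using index_antimono that by blast
  with assms show ?thesis
    using kite_unit_closed by (auto simp: ab PiE_iff rdiv_closed not_less)
qed

lemma kite_meet_closed: "\<lbrakk>a \<in> carrier K; b \<in> carrier K\<rbrakk> \<Longrightarrow> kite_meet a b \<in> carrier K"
  using kite_glb by (rule greatest_closed)

lemma kite_join_closed: "\<lbrakk>a \<in> carrier K; b \<in> carrier K\<rbrakk> \<Longrightarrow> kite_join a b \<in> carrier K"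
  using kite_lub by (rule least_closed)

lemma kite_congI:
  assumes "a \<in> carrier K" "b \<in> carrier K" "fst a = fst b"
    and "\<And>i. \<lbrakk>i \<in> I (fst a); i \<in> J\<rbrakk> \<Longrightarrow> (snd a i, snd b i) \<in> \<theta>"
  shows "(a, b) \<in> kite_cong J \<theta>"
  using assms by (cases a; cases b) (auto simp: kite_cong_def)

lemma kite_congE:
  assumes "(a, b) \<in> kite_cong J \<theta>"
  obtains n x y where "a = (n, x)" "b = (n, y)" "a \<in> carrier K" "b \<in> carrier K"
    "\<forall>i\<in>I n \<inter> J. (x i, y i) \<in> \<theta>"
  using assms that by (cases a; cases b) (auto simp: kite_cong_def)

text \<open>
  For an operation whose result level depends only on the levels of its arguments,
  compatibility can be checked one coordinate at a time. All operations of a kite are of this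
  kind.
\<close>

lemma compatible_op_kite_cong:
  assumes closed: "\<And>a b. \<lbrakk>a \<in> carrier K; b \<in> carrier K\<rbrakk> \<Longrightarrow> f a b \<in> carrier K"
    and level: "\<And>m x n y x' y'. fst (f (m, x) (n, y)) = fst (f (m, x') (n, y'))"
    and coord: "\<And>m x n y x' y' i. \<lbrakk>(m, x) \<in> carrier K; (m, x') \<in> carrier K; (n, y) \<in> carrier K; (n, y') \<in> carrier K;
       \<And>i. \<lbrakk>i \<in> I m; i \<in> J\<rbrakk> \<Longrightarrow> (x i, x' i) \<in> \<theta>; \<And>i. \<lbrakk>i \<in> I n; i \<in> J\<rbrakk> \<Longrightarrow> (y i, y' i) \<in> \<theta>;
       i \<in> I (fst (f (m, x) (n, y))); i \<in> J\<rbrakk>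
       \<Longrightarrow> (snd (f (m, x) (n, y)) i, snd (f (m, x') (n, y')) i) \<in> \<theta>"
  shows "compatible_op (kite_cong J \<theta>) f"
  unfolding compatible_op_def
proof (intro allI impI)
  fix a a' b b' assume "(a, a') \<in> kite_cong J \<theta>" "(b, b') \<in> kite_cong J \<theta>"
  then obtain m x x' n y y' where ab: "a = (m, x)" "a' = (m, x')" "b = (n, y)" "b' = (n, y')"
    and car: "a \<in> carrier K" "a' \<in> carrier K" "b \<in> carrier K" "b' \<in> carrier K"
    and rel: "\<And>i. \<lbrakk>i \<in> I m; i \<in> J\<rbrakk> \<Longrightarrow> (x i, x' i) \<in> \<theta>" "\<And>i. \<lbrakk>i \<in> I n; i \<in> J\<rbrakk> \<Longrightarrow> (y i, y' i) \<in> \<theta>"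
    by (elim kite_congE) blast
  show "(f a b, f a' b') \<in> kite_cong J \<theta>"
  proof (rule kite_congI)
    show "f a b \<in> carrier K" "f a' b' \<in> carrier K" using closed car by auto
    show "fst (f a b) = fst (f a' b')" unfolding ab by (rule level)
    show "(snd (f a b) i, snd (f a' b') i) \<in> \<theta>" if "i \<in> I (fst (f a b))" "i \<in> J" for i
      using car rel that unfolding ab by (intro coord)
  qed
qed

lemma compatible_op_cong:
  assumes "compatible_op \<theta> f"
    and "\<And>x y. \<lbrakk>x \<in> Field \<theta>; y \<in> Field \<theta>\<rbrakk> \<Longrightarrow> f x y = g x y"
  shows "compatible_op \<theta> g"
  unfolding compatible_op_def
proof (intro allI impI)
  fix x x' y y' assume xy: "(x, x') \<in> \<theta>" "(y, y') \<in> \<theta>"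
  then have "x \<in> Field \<theta>" "x' \<in> Field \<theta>" "y \<in> Field \<theta>" "y' \<in> Field \<theta>"
    by (auto intro: FieldI1 FieldI2)
  with assms xy show "(g x y, g x' y') \<in> \<theta>"
    by (metis compatible_op_def)
qed

text \<open>
  Each coordinate of a result is the unit, a coordinate of an argument, or an operation of \<open>\<^bold>G\<close>
  applied to coordinates that differ from the given one by a power of \<open>\<lambda>\<close>, and an invariant
  \<open>J\<close> contains all of these as soon as it contains one.
\<close>

lemma kite_congruence:
  assumes \<theta>: "rlat_congruence G \<theta>" and J: "invariant J"
  shows "rlat_congruence K (kite_cong J \<theta>)"
proof -
  have eq: "equiv (carrier G) \<theta>"
    and op: "compatible_op \<theta> (\<sqinter>)" "compatible_op \<theta> (\<squnion>)" "compatible_op \<theta> (\<odot>)"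
      "compatible_op \<theta> (ldiv G)" "compatible_op \<theta> (rdiv G)"
    using \<theta> by (auto simp: rlat_congruence_def)
  have refl: "(a, a) \<in> \<theta>" if "a \<in> carrier G" for a
    using eq that by (auto elim!: equivE dest: refl_onD)
  have unit: "(snd (kite_unit I0 I1 l G) i, snd (kite_unit I0 I1 l G) i) \<in> \<theta>" if "i \<in> I n" for i n
    using that index_subset by (auto simp: kite_unit_def refl)
  have equiv: "equiv (carrier K) (kite_cong J \<theta>)"
  proof (rule equivI)
    show "kite_cong J \<theta> \<subseteq> carrier K \<times> carrier K" by (auto simp: kite_cong_def)
    show "refl_on (carrier K) (kite_cong J \<theta>)"
      by (rule refl_onI) (auto simp: kite_cong_def PiE_iff refl)
    show "sym (kite_cong J \<theta>)"
      using eq by (auto intro!: symI simp: kite_cong_def elim!: equivE dest: symD)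
    show "trans (kite_cong J \<theta>)"
      using eq by (auto intro!: transI simp: kite_cong_def elim!: equivE) (meson IntI transD)
  qed
  have field: "Field (kite_cong J \<theta>) \<subseteq> carrier K"
    by (auto simp: Field_def kite_cong_def)
  have "compatible_op (kite_cong J \<theta>) kite_meet"
    using op(1) by (intro compatible_op_kite_cong kite_meet_closed)
      (auto simp: kite_meet_def compatible_op_def split: if_splits)
  then have "compatible_op (kite_cong J \<theta>) (meet K)"
    by (rule compatible_op_cong) (rule kite_meet_eq[OF field[THEN subsetD] field[THEN subsetD], symmetric])
  moreover have "compatible_op (kite_cong J \<theta>) kite_join"
    using op(2) by (intro compatible_op_kite_cong kite_join_closed)
      (auto simp: kite_join_def compatible_op_def split: if_splits)
  then have "compatible_op (kite_cong J \<theta>) (join K)"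
    by (rule compatible_op_cong) (rule kite_join_eq[OF field[THEN subsetD] field[THEN subsetD], symmetric])
  moreover have "compatible_op (kite_cong J \<theta>) (rmult K)"
    using op(3) invariant_funpow[OF J] by (intro compatible_op_kite_cong kite_mult_closed)
      (auto simp: compatible_op_def mem_index_add_iff)
  moreover have "compatible_op (kite_cong J \<theta>) (ldiv K)"
  proof (intro compatible_op_kite_cong kite_ldiv_closed, goal_cases)
    case (4 n y m x y' x' i)
    show ?case
    proof (cases "n \<le> m")
      case True
      then have "(l ^^ (m - n)) i \<in> I n \<and> ((l ^^ (m - n)) i \<in> J \<longleftrightarrow> i \<in> J)" if "i \<in> I m"
        using mem_index_add_iff[of i n "m - n"] that invariant_funpow[OF J, of i "m - n"]
          index_antimono[of "m - n" m] by auto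
      with 4 True show ?thesis using op(4) by (auto simp: compatible_op_def refl)
    qed (use 4 unit in auto)
  qed auto
  moreover have "compatible_op (kite_cong J \<theta>) (rdiv K)"
  proof (intro compatible_op_kite_cong kite_rdiv_closed, goal_cases)
    case (4 n y m x y' x' i)
    show ?case
    proof (cases "m \<le> n \<and> i \<in> (l ^^ m) ` I n")
      case True
      then obtain k where k: "k \<in> I n" "k \<in> I m" "i = (l ^^ m) k" "m \<le> n"
        using index_antimono[of m n] by auto
      moreover from this 4 have "k \<in> J" using invariant_funpow[OF J, of k m] by auto
      ultimately show ?thesis using 4 op(5) by (auto simp: compatible_op_def)
    qed (use 4 unit refl in auto)
  qed auto
  ultimately show ?thesis
    unfolding rlat_congruence_def using equiv by blast
qed


section \<open>Consequences of subdirect irreducibility\<close>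

text \<open>
  Two elements of level \<open>0\<close> that differ at a single coordinate \<open>i\<close> are related, provided that
  \<open>\<theta>\<close> relates their values there or \<open>J\<close> does not see \<open>i\<close>.
\<close>

lemma kite_cong_nontrivial:
  assumes "i \<in> I0" and "a \<in> carrier G" "b \<in> carrier G" "a \<noteq> b"
    and \<theta>: "\<And>c. c \<in> carrier G \<Longrightarrow> (c, c) \<in> \<theta>" and "i \<in> J \<Longrightarrow> (a, b) \<in> \<theta>"
  shows "kite_cong J \<theta> \<noteq> Id_on (carrier K)"
proof -
  define p :: "nat \<times> ('i \<Rightarrow> 'a)" where "p = (0, \<lambda>j\<in>I0. a)"
  define q :: "nat \<times> ('i \<Rightarrow> 'a)" where "q = (0, \<lambda>j\<in>I0. if j = i then b else a)"
  have "(p, q) \<in> kite_cong J \<theta>"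
    using assms by (intro kite_congI) (auto simp: p_def q_def PiE_iff)
  moreover have "snd p i \<noteq> snd q i"
    using assms(1,4) by (simp add: p_def q_def)
  ultimately show ?thesis by (metis Id_onE Pair_inject)
qed

text \<open>
  The least congruence would lie below agreement on \<open>J\<close> and below agreement on the complement of
  \<open>J\<close>, hence below the identity.
\<close>

lemma subdirectly_irreducible_connected:
  assumes si: "subdirectly_irreducible K" and G: "nontrivial_rlat G"
    and J: "invariant J" "J \<subseteq> I0" "J \<noteq> {}"
  shows "J = I0"
proof (rule ccontr)
  assume "J \<noteq> I0"
  then obtain i j where ij: "i \<in> J" "i \<in> I0" "j \<in> I0 - J" using J by blast
  obtain a where a: "a \<in> carrier G" "a \<noteq> runit G"
    using G runit_closed unfolding nontrivial_rlat_def by blast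
  have Id: "rlat_congruence G (Id_on (carrier G))"
    by (rule Id_on_congruence) (rule residuated_lattice_axioms)
  obtain \<mu> where \<mu>: "rlat_congruence K \<mu>" "\<mu> \<noteq> Id_on (carrier K)"
    and least: "\<And>\<theta>. \<lbrakk>rlat_congruence K \<theta>; \<theta> \<noteq> Id_on (carrier K)\<rbrakk> \<Longrightarrow> \<mu> \<subseteq> \<theta>"
    using si unfolding subdirectly_irreducible_def by blast
  have J': "invariant (I0 - J)"
    using J(1) l_closed I1_subset unfolding invariant_def by blast
  have "\<mu> \<subseteq> kite_cong J (Id_on (carrier G))"
    using ij a kite_congruence[OF Id J(1)]
    by (intro least kite_cong_nontrivial[where i = j and a = a and b = "runit G"]) auto
  moreover have "\<mu> \<subseteq> kite_cong (I0 - J) (Id_on (carrier G))"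
    using ij a kite_congruence[OF Id J']
    by (intro least kite_cong_nontrivial[where i = i and a = a and b = "runit G"]) auto
  moreover have "p = q" if pqJ: "(p, q) \<in> kite_cong J (Id_on (carrier G))"
    and pqJ': "(p, q) \<in> kite_cong (I0 - J) (Id_on (carrier G))" for p q
  proof -
    obtain n x y where pq: "p = (n, x)" "q = (n, y)" "p \<in> carrier K" "q \<in> carrier K"
      and inJ: "\<forall>i\<in>I n \<inter> J. (x i, y i) \<in> Id_on (carrier G)"
      by (rule kite_congE[OF pqJ])
    have "(x i, y i) \<in> Id_on (carrier G)" if "i \<in> I n" "i \<notin> J" for i
      using pqJ' pq that index_subset[of n] by (simp add: kite_cong_def subset_iff)
    with inJ have "\<forall>i\<in>I n. x i = y i" by (metis Id_on_iff IntI)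
    then show ?thesis using kite_eq_iff[of n x y] pq by simp
  qed
  moreover have "equiv (carrier K) \<mu>" using \<mu> by (simp add: rlat_congruence_def)
  then obtain p q where "(p, q) \<in> \<mu>" "p \<noteq> q" using \<mu>(2) by (rule equiv_ne_Id_onE)
  ultimately show False by blast
qed

text \<open>
  With a single index, \<open>\<^bold>G\<close> is the subalgebra of level \<open>0\<close>. The restriction \<open>\<nu>\<close> of the least
  congruence \<open>\<mu>\<close> lies below every non-identity \<open>\<theta>\<close> because \<open>\<mu>\<close> lies below the lift of \<open>\<theta>\<close>.
  What needs care is that \<open>\<nu>\<close> is not the identity, as the pairs in \<open>\<mu>\<close> could all live at higher
  levels: the lift of the total congruence shows that related elements have equal level, and
  dividing them by each other then produces two elements of level \<open>0\<close> that are related to the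
  unit, and at most one of them equals it.
\<close>

lemma subdirectly_irreducible_base:
  assumes si: "subdirectly_irreducible K" and G: "nontrivial_rlat G" and I0: "I0 = {i}"
  shows "subdirectly_irreducible G"
proof -
  obtain a where a: "a \<in> carrier G" "a \<noteq> runit G"
    using G runit_closed unfolding nontrivial_rlat_def by blast
  obtain \<mu> where \<mu>: "rlat_congruence K \<mu>" "\<mu> \<noteq> Id_on (carrier K)"
    and least: "\<And>\<theta>. \<lbrakk>rlat_congruence K \<theta>; \<theta> \<noteq> Id_on (carrier K)\<rbrakk> \<Longrightarrow> \<mu> \<subseteq> \<theta>"
    using si unfolding subdirectly_irreducible_def by blast
  define c :: "'a \<Rightarrow> nat \<times> ('i \<Rightarrow> 'a)" where "c = (\<lambda>a. (0, \<lambda>_\<in>{i}. a))"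
  define \<nu> where "\<nu> = {(a, b). a \<in> carrier G \<and> b \<in> carrier G \<and> (c a, c b) \<in> \<mu>}"
  have c_closed: "c a \<in> carrier K" if "a \<in> carrier G" for a
    unfolding c_def kite_mem_iff using that by (simp add: I0)
  have UNIV: "invariant UNIV" by (simp add: invariant_def)
  have "preserves_op c (carrier G) (\<sqinter>) (meet K)" "preserves_op c (carrier G) (\<squnion>) (join K)"
    unfolding preserves_op_def using c_closed
    by (simp_all add: kite_meet_eq kite_join_eq)
      (simp_all add: c_def kite_meet_def kite_join_def, simp_all add: I0 fun_eq_iff)
  moreover have "preserves_op c (carrier G) (\<odot>) (rmult K)" "preserves_op c (carrier G) (ldiv G) (ldiv K)"
    "preserves_op c (carrier G) (rdiv G) (rdiv K)"
    unfolding preserves_op_def by (simp_all add: c_def) (simp_all add: I0 fun_eq_iff inv_into_id_singleton)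
  ultimately have "rlat_congruence G \<nu>"
    unfolding \<nu>_def using \<mu>(1) c_closed
    by (intro congruence_pullback[where B = K] residuated_lattice_axioms) auto
  moreover have "\<nu> \<subseteq> \<theta>" if \<theta>: "rlat_congruence G \<theta>" "\<theta> \<noteq> Id_on (carrier G)" for \<theta>
  proof -
    have eq: "equiv (carrier G) \<theta>" using \<theta> by (simp add: rlat_congruence_def)
    then obtain a b where "(a, b) \<in> \<theta>" "a \<in> carrier G" "b \<in> carrier G" "a \<noteq> b"
      using \<theta>(2) by (rule equiv_ne_Id_onE)
    then have "\<mu> \<subseteq> kite_cong UNIV \<theta>"
      using eq kite_congruence[OF \<theta>(1) UNIV]
      by (intro least kite_cong_nontrivial[where i = i and a = a and b = b])
        (auto simp: I0 elim!: equivE dest: refl_onD)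
    moreover have "(a, b) \<in> \<theta>" if "(c a, c b) \<in> kite_cong UNIV \<theta>" for a b
      using that unfolding kite_cong_def c_def by (simp add: I0)
    ultimately show ?thesis by (auto simp: \<nu>_def)
  qed
  moreover have "\<nu> \<noteq> Id_on (carrier G)"
  proof
    assume \<nu>: "\<nu> = Id_on (carrier G)"
    have eq: "equiv (carrier K) \<mu>" using \<mu> by (simp add: rlat_congruence_def)
    then obtain p q where pq: "(p, q) \<in> \<mu>" "p \<noteq> q"
      using \<mu>(2) by (rule equiv_ne_Id_onE)
    have "\<mu> \<subseteq> kite_cong UNIV (carrier G \<times> carrier G)"
      using a kite_congruence[OF total_congruence[OF residuated_lattice_axioms] UNIV]
      by (intro least kite_cong_nontrivial[where i = i and a = a and b = "runit G"]) (auto simp: I0)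
    then obtain n x y where p: "p = (n, x)" and q: "q = (n, y)"
      and car: "p \<in> carrier K" "q \<in> carrier K"
      using pq(1) by (auto simp: kite_cong_def)
    then have i: "i \<in> I n" "x i \<noteq> y i"
      using pq(2) kite_eq_iff[of n x y] index_subset[of n] by (auto simp: I0)
    have xy: "x i \<in> carrier G" "y i \<in> carrier G" using car p q i by auto
    have ldiv: "ldiv K p q = c (ldiv G (x i) (y i))" "ldiv K q p = c (ldiv G (y i) (x i))"
      "ldiv K p p = c (runit G)" "ldiv K q q = c (runit G)"
      using i(1) xy by (simp_all add: p q c_def) (simp_all add: I0 fun_eq_iff ldiv_eq_unit_iff)
    have sym: "(q, p) \<in> \<mu>" and refl: "(p, p) \<in> \<mu>" "(q, q) \<in> \<mu>"
      using eq pq car by (auto elim!: equivE dest: symD refl_onD)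
    have "(c (ldiv G (x i) (y i)), c (runit G)) \<in> \<mu>" "(c (ldiv G (y i) (x i)), c (runit G)) \<in> \<mu>"
      using \<mu>(1) pq(1) sym refl ldiv unfolding rlat_congruence_def compatible_op_def by metis+
    then have "(ldiv G (x i) (y i), runit G) \<in> \<nu>" "(ldiv G (y i) (x i), runit G) \<in> \<nu>"
      using xy by (auto simp: \<nu>_def ldiv_closed)
    then have "x i \<sqsubseteq> y i" "y i \<sqsubseteq> x i"
      using xy unfolding \<nu> Id_on_iff by (simp_all add: ldiv_eq_unit_iff[symmetric])
    then have "x i = y i" using xy by (intro antisym)
    with i show False by blast
  qed
  ultimately show ?thesis
    unfolding subdirectly_irreducible_def using G by blast
qed

end


section \<open>Connected finite index systems are cycles and paths\<close>

text \<open>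
  Follow the orbit of a vertex \<open>i\<^sub>0\<close> until it leaves \<open>I\<^sub>1\<close> or returns to \<open>i\<^sub>0\<close>. By injectivity
  the vertices met so far are distinct, so finiteness stops the walk. If \<open>I\<^sub>1\<close> is smaller than
  \<open>I\<^sub>0\<close>, then so is the image of \<open>\<lambda>\<close>, and \<open>i\<^sub>0\<close> is chosen outside it; this makes the visited
  vertices closed under preimages, hence they are everything by connectedness.
\<close>

lemma (in kite_indices) connected_cycle_or_path:
  assumes fin: "finite I0" and ne: "I0 \<noteq> {}"
    and conn: "\<And>J. \<lbrakk>invariant J; J \<subseteq> I0; J \<noteq> {}\<rbrakk> \<Longrightarrow> J = I0"
  shows "\<exists>N f. bij_betw f {0..<Suc N} I0 \<and>
    (I1 = I0 \<and> (\<forall>k<Suc N. l (f k) = f ((k + 1) mod Suc N)) \<or>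
     I1 = f ` {0..<N} \<and> (\<forall>k<N. l (f k) = f (k + 1)))"
proof -
  \<comment> \<open>A proper \<open>I1\<close> is too small for \<open>l\<close> to be onto, which provides a start for the walk.\<close>
  have "I1 = I0" if "I0 \<subseteq> l ` I1"
  proof (rule card_subset_eq[OF fin I1_subset])
    have "finite I1" using fin I1_subset by (rule rev_finite_subset)
    then have "card I0 \<le> card I1" using that by (meson card_image_le card_mono finite_imageI le_trans)
    then show "card I1 = card I0" using card_mono[OF fin I1_subset] by simp
  qed
  then obtain i0 where i0: "i0 \<in> I0" and start: "i0 \<in> l ` I1 \<Longrightarrow> I1 = I0"
    using ne by blast
  define f where "f k = (l ^^ k) i0" for k
  have f0: "f 0 = i0" and fS: "f (Suc k) = l (f k)" for k
    by (simp_all add: f_def)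
  have f_mem: "f k \<in> I0" if "\<And>j. j < k \<Longrightarrow> f j \<in> I1" for k :: nat
    using that l_closed i0 by (cases k) (auto simp: f0 fS)
  \<comment> \<open>Two equal vertices of the walk could be moved back in step until the first is \<open>i0\<close>.\<close>
  have f_inj: "inj_on f {0..<Suc M}" if M: "\<And>j. j < M \<Longrightarrow> f j \<in> I1 \<and> f (Suc j) \<noteq> i0" for M
  proof -
    have return: "f d = i0" if "f a = f (a + d)" "a + d \<le> M" for a d
      using that
    proof (induction a)
      case (Suc a)
      then have "f a = f (a + d)"
        using M[of a] M[of "a + d"] l_inj by (auto simp: fS dest: inj_onD)
      with Suc show ?case by simp
    qed (simp add: f0)
    have False if ab: "f a = f b" "a < b" "b \<le> M" for a b
      using return[of a "b - a"] M[of "b - a - 1"] ab by (fastforce simp: Suc_diff_Suc)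
    then show ?thesis
      by (intro linorder_inj_onI) (auto simp: less_Suc_eq_le)
  qed
  have "\<exists>k. f k \<notin> I1 \<or> f (Suc k) = i0"
  proof (rule ccontr)
    assume *: "\<not> ?thesis"
    then have "card (f ` {0..<Suc (card I0)}) = Suc (card I0)"
      by (subst card_image) (auto intro: f_inj)
    moreover have "f ` {0..<Suc (card I0)} \<subseteq> I0" using * f_mem by auto
    ultimately show False using card_mono[OF fin, of "f ` {0..<Suc (card I0)}"] by linarith
  qed
  \<comment> \<open>The last index before the walk stops, so that there are \<open>Suc N\<close> vertices.\<close>
  then have "\<exists>N. (f N \<notin> I1 \<or> f (Suc N) = i0) \<and> (\<forall>j<N. \<not> (f j \<notin> I1 \<or> f (Suc j) = i0))"
    by (rule exists_least_iff[THEN iffD1])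
  then obtain N where N: "f N \<notin> I1 \<or> f (Suc N) = i0"
    and before: "\<And>j. j < N \<Longrightarrow> f j \<in> I1 \<and> f (Suc j) \<noteq> i0"
    by blast
  let ?J = "f ` {0..<Suc N}"
  have "invariant ?J"
    unfolding invariant_def
  proof (intro ballI iffI)
    fix i assume i: "i \<in> I1"
    show "l i \<in> ?J" if "i \<in> ?J"
    proof -
      obtain k where k: "k \<le> N" "i = f k" using \<open>i \<in> ?J\<close> by (auto simp: less_Suc_eq_le)
      then have "l i = f (if k = N then 0 else Suc k)" using N i by (auto simp: f0 fS)
      with k show ?thesis by auto
    qed
    show "i \<in> ?J" if "l i \<in> ?J"
    proof -
      obtain k where k: "k \<le> N" "l i = f k" using \<open>l i \<in> ?J\<close> by (auto simp: less_Suc_eq_le)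
      show ?thesis
      proof (cases k)
        case 0
        then have "I1 = I0" using k i by (intro start) (auto simp: f0)
        then have "f N \<in> I1" using f_mem before by simp
        then have "l i = l (f N)" using N k 0 by (simp add: f0 fS)
        then have "i = f N" using i \<open>f N \<in> I1\<close> l_inj by (auto dest: inj_onD)
        then show ?thesis by simp
      next
        case (Suc k')
        then have "i = f k'" using i k before[of k'] l_inj by (auto simp: fS dest: inj_onD)
        then show ?thesis using k Suc by simp
      qed
    qed
  qed
  moreover have "?J \<subseteq> I0" using f_mem before by auto
  ultimately have J: "?J = I0" by (intro conn) auto
  have "bij_betw f {0..<Suc N} I0"
    using f_inj[OF before] J by (simp add: bij_betw_def)
  moreover have "l (f k) = f ((k + 1) mod Suc N)" if "I1 = I0" "k < Suc N" for k
    using that N f_mem[of N] before by (cases "k = N") (auto simp: f0 simp flip: fS)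
  moreover have "I1 = f ` {0..<N}" if "I1 \<noteq> I0"
  proof -
    have "f N \<notin> I1" using N start that by (auto simp: fS)
    moreover have "I1 \<subseteq> ?J" using J I1_subset by simp
    ultimately show ?thesis using before by (auto simp: atLeast0_lessThan_Suc)
  qed
  ultimately show ?thesis
    by (intro exI[of _ N] exI[of _ f]) (auto simp: fS)
qed


section \<open>Isomorphisms of kites\<close>

text \<open>
  A bijection of index sets that intertwines the partial maps also intertwines their powers with
  their domains, and the kite operations use nothing else; elements are reindexed by composition.
\<close>

lemma (in kite_algebra) relabel_iso:
  fixes g :: "'j \<Rightarrow> 'i"
  assumes J: "J1 \<subseteq> J0" "l' ` J1 \<subseteq> J0" and g: "bij_betw g J0 I0" "g ` J1 = I1"
    and comm: "\<And>j. j \<in> J1 \<Longrightarrow> g (l' j) = l (g j)"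
  shows "K \<cong>\<^sub>R kite J0 J1 l' G"
proof -
  have g_inj: "inj_on g J0" using g(1) by (simp add: bij_betw_def)
  interpret T: kite_algebra J0 J1 l' G
  proof
    show "inj_on l' J1"
    proof (rule inj_onI)
      fix a b assume ab: "a \<in> J1" "b \<in> J1" "l' a = l' b"
      then have "l (g a) = l (g b)" using comm by metis
      then have "g a = g b" using l_inj ab g(2) by (auto dest: inj_onD)
      then show "a = b" using g_inj ab J(1) by (auto dest: inj_onD)
    qed
  qed (use J in auto)
  have mem_index: "j \<in> T.I n \<longleftrightarrow> g j \<in> I n" and power: "j \<in> T.I n \<Longrightarrow> g ((l' ^^ n) j) = (l ^^ n) (g j)"
    if "j \<in> J0" for j n
  proof (induction n)
    case 0
    { case 1 then show ?case using that g(1) by (auto simp: bij_betw_def) }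
    { case 2 then show ?case by simp }
  next
    case (Suc n)
    have *: "(l' ^^ n) j \<in> J1 \<longleftrightarrow> (l ^^ n) (g j) \<in> I1" if "j \<in> T.I n"
      using Suc.IH(2)[OF that] T.funpow_mem_I0[OF that] g_inj J(1) g(2)
      by (metis imageI inj_on_image_mem_iff)
    { case 1 then show ?case using * Suc.IH(1) by (auto simp: T.mem_index_Suc_iff mem_index_Suc_iff) }
    { case 2 then show ?case using Suc.IH(2) comm by (auto simp: T.mem_index_Suc_iff) }
  qed
  have T_I0: "j \<in> J0" if "j \<in> T.I n" for j n
    using that T.index_subset by blast
  have g_index: "g ` T.I n = I n" for n
  proof -
    have "i \<in> g ` T.I n" if "i \<in> I n" for i
    proof -
      have "i \<in> g ` J0" using that index_subset g(1) by (auto simp: bij_betw_def)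
      with that mem_index show ?thesis by blast
    qed
    then show ?thesis using mem_index T_I0 by blast
  qed
  have g_mem: "g j \<in> I n" if "j \<in> T.I n" for j n
    using that g_index by blast
  define h :: "nat \<times> ('i \<Rightarrow> 'a) \<Rightarrow> nat \<times> ('j \<Rightarrow> 'a)" where
    "h = (\<lambda>(n, x). (n, \<lambda>j\<in>T.I n. x (g j)))"
  define h' :: "nat \<times> ('j \<Rightarrow> 'a) \<Rightarrow> nat \<times> ('i \<Rightarrow> 'a)" where
    "h' = (\<lambda>(n, x). (n, \<lambda>i\<in>I n. x (inv_into J0 g i)))"
  have inv1: "inv_into J0 g (g j) = j" if "j \<in> T.I n" for j n
    using T_I0[OF that] g_inj by simp
  have inv2: "g (inv_into J0 g i) = i" "inv_into J0 g i \<in> T.I n" if "i \<in> I n" for i n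
    using that inv1 unfolding g_index[symmetric] by auto
  \<comment> \<open>The case distinction in the right division asks for membership in this image.\<close>
  have rdiv: "(l' ^^ m) ` T.I n = {j \<in> J0. g j \<in> (l ^^ m) ` I n}" if "m \<le> n" for m n
  proof -
    have "g ((l' ^^ m) j) = (l ^^ m) (g j)" "(l' ^^ m) j \<in> J0" if "j \<in> T.I n" for j
      using power[OF T_I0[OF that], of m] T.index_antimono[OF \<open>m \<le> n\<close>] T.funpow_mem_I0 that by auto
    note g_power = this
    show ?thesis
    proof (intro equalityI subsetI)
      fix j assume "j \<in> (l' ^^ m) ` T.I n"
      then obtain k where "k \<in> T.I n" "j = (l' ^^ m) k" by blast
      with g_power[of k] g_index show "j \<in> {j \<in> J0. g j \<in> (l ^^ m) ` I n}" by blast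
    next
      fix j assume "j \<in> {j \<in> J0. g j \<in> (l ^^ m) ` I n}"
      then obtain k where "j \<in> J0" "k \<in> T.I n" "g j = (l ^^ m) (g k)"
        unfolding g_index[symmetric] by blast
      then have "g j = g ((l' ^^ m) k)" using g_power[of k] by simp
      then have "j = (l' ^^ m) k"
        using inj_onD[OF g_inj] g_power[of k] \<open>j \<in> J0\<close> \<open>k \<in> T.I n\<close> by blast
      with \<open>k \<in> T.I n\<close> show "j \<in> (l' ^^ m) ` T.I n" by blast
    qed
  qed
  have unit: "h (kite_unit I0 I1 l G) = kite_unit J0 J1 l' G"
    using g(1) by (auto simp: h_def kite_unit_def fun_eq_iff bij_betw_def)
  have h_simps: "h (n, x) = (n, \<lambda>j\<in>T.I n. x (g j))" for n x
    by (simp add: h_def)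
  show ?thesis
  proof (rule rlat_isoI[OF kite_lattice])
    show "bij_betw h (carrier K) (carrier T.K)"
    proof (rule bij_betw_byWitness[where f' = h'])
      have "h' (h (n, x)) = (n, x)" if "(n, x) \<in> carrier K" for n x
        using that inv2 by (auto simp: h_def h'_def PiE_iff intro!: extensionalityI[of _ "I n"])
      then show "\<forall>a\<in>carrier K. h' (h a) = a" by fast
      have "h (h' (n, x)) = (n, x)" if "(n, x) \<in> carrier T.K" for n x
        using that inv1 g_index[of n]
        by (auto simp: h_def h'_def PiE_iff intro!: extensionalityI[of _ "T.I n"])
      then show "\<forall>a\<in>carrier T.K. h (h' a) = a" by fast
      show "h ` carrier K \<subseteq> carrier T.K"
        using g_mem by (auto simp: h_def PiE_iff)
      show "h' ` carrier T.K \<subseteq> carrier K"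
        using inv2 by (auto simp: h'_def PiE_iff)
    qed
    show "le T.K (h a) (h b) \<longleftrightarrow> le K a b" for a b
      by (cases a; cases b) (auto simp: h_def simp flip: g_index)
    show "h (rmult K a b) = rmult T.K (h a) (h b)" for a b
    proof -
      obtain m x n y where ab: "a = (m, x)" "b = (n, y)" by (cases a; cases b)
      have "j \<in> T.I n \<and> (l' ^^ n) j \<in> T.I m \<and> g ((l' ^^ n) j) = (l ^^ n) (g j)"
        if "j \<in> T.I (m + n)" for j
        using that power[OF T_I0[OF that]] by (simp add: T.mem_index_add_iff)
      then show ?thesis using g_mem by (auto simp: ab h_def fun_eq_iff)
    qed
    show "h (ldiv K a b) = ldiv T.K (h a) (h b)" for a b
    proof -
      obtain n y m x where ab: "a = (n, y)" "b = (m, x)" by (cases a; cases b)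
      show ?thesis
      proof (cases "n \<le> m")
        case True
        have "(l' ^^ (m - n)) j \<in> T.I n \<and> g ((l' ^^ (m - n)) j) = (l ^^ (m - n)) (g j)"
          if "j \<in> T.I m" for j
          using T.mem_index_add_iff[of j n "m - n"] that True power[of j "m - n"] T_I0[OF that] by auto
        moreover have "g j \<in> I (m - n) \<and> (g j \<in> I m \<longleftrightarrow> j \<in> T.I m)" if "j \<in> T.I (m - n)" for j
          using g_mem[OF that] mem_index[OF T_I0[OF that]] by simp
        ultimately show ?thesis
          using True by (simp add: ab h_def fun_eq_iff)
      qed (use unit in \<open>simp add: ab h_simps\<close>)
    qed
    show "h (rdiv K a b) = rdiv T.K (h a) (h b)" for a b
    proof -
      obtain n y m x where ab: "a = (n, y)" "b = (m, x)" by (cases a; cases b)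
      show ?thesis
      proof (cases "m \<le> n")
        case True
        have eq: "g (inv_into (T.I m) (l' ^^ m) j) = inv_into (I m) (l ^^ m) (g j)
            \<and> inv_into (T.I m) (l' ^^ m) j \<in> T.I n \<and> inv_into (T.I m) (l' ^^ m) j \<in> T.I m"
          if j: "j \<in> (l' ^^ m) ` T.I n" for j
        proof -
          obtain k where k: "k \<in> T.I n" "k \<in> T.I m" "j = (l' ^^ m) k"
            using j T.index_antimono[OF True] by blast
          then have "g j = (l ^^ m) (g k)" "g k \<in> I n"
            using power[OF T_I0] g_mem by auto
          with k True show ?thesis by simp
        qed
        have "g j \<in> (l ^^ m) ` I n \<longleftrightarrow> j \<in> (l' ^^ m) ` T.I n" if "j \<in> T.I (n - m)" for j
          using rdiv[OF True] T_I0[OF that] by blast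
        then show ?thesis
          using True eq g_mem by (simp add: ab h_def fun_eq_iff)
      qed (use unit in \<open>simp add: ab h_simps\<close>)
    qed
    show "h (runit K) = runit T.K" using unit by simp
  qed
qed

lemma empty_kite_iso_Z_minus:
  fixes G :: "'a rlat"
  assumes "integral_residuated_lattice G"
  shows "kite ({} :: 'i set) {} l G \<cong>\<^sub>R Z_minus"
proof -
  interpret integral_residuated_lattice G by fact
  interpret kite_algebra "{} :: 'i set" "{}" l G by unfold_locales auto
  have I: "I n = {}" for n using index_subset by blast
  show ?thesis
  proof (rule rlat_isoI[OF kite_lattice, where h = "\<lambda>(n, _). - int n"])
    show "bij_betw (\<lambda>(n, _). - int n) (carrier K) (carrier Z_minus)"
      by (rule bij_betw_byWitness[where f' = "\<lambda>a. (nat (- a), \<lambda>_. undefined)"])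
        (auto simp: Z_minus_def I)
  qed (auto simp: Z_minus_def I kite_unit_def)
qed

lemma singleton_kite_iso_antilex:
  fixes G :: "'a rlat"
  assumes "integral_residuated_lattice G"
  shows "kite {i} {i} id G \<cong>\<^sub>R antilex_Z_minus G"
proof -
  interpret integral_residuated_lattice G by fact
  interpret kite_algebra "{i}" "{i}" id G by unfold_locales auto
  have I: "I n = {i}" for n by (auto simp: mem_index_iff)
  show ?thesis
  proof (rule rlat_isoI[OF kite_lattice, where h = "\<lambda>(n, x). (x i, - int n)"])
    show "bij_betw (\<lambda>(n, x). (x i, - int n)) (carrier K) (carrier (antilex_Z_minus G))"
      by (rule bij_betw_byWitness[where f' = "\<lambda>(b, a). (nat (- a), \<lambda>_\<in>{i}. b)"])
        (auto simp: antilex_Z_minus_def I PiE_iff intro!: extensionalityI[of _ "{i}"])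
  qed (auto simp: antilex_Z_minus_def I kite_unit_def inv_into_id_singleton)
qed


section \<open>The classification\<close>

theorem theorem5p8:
  fixes G :: "'a rlat" and I0 I1 :: "'i set" and l :: "'i \<Rightarrow> 'i"
  assumes "integral_residuated_lattice G" and "nontrivial_rlat G"
    and "I1 \<subseteq> I0" and "finite I0"
    and "l ` I1 \<subseteq> I0" and "inj_on l I1"
    and "subdirectly_irreducible (kite I0 I1 l G)"
  shows
    "(kite I0 I1 l G \<cong>\<^sub>R kite ({} :: nat set) {} empty_map G
        \<and> kite ({} :: nat set) {} empty_map G \<cong>\<^sub>R Z_minus)
     \<or> (kite I0 I1 l G \<cong>\<^sub>R kite {0 :: nat} {0} id G
        \<and> kite {0 :: nat} {0} id G \<cong>\<^sub>R antilex_Z_minus G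
        \<and> subdirectly_irreducible G)
     \<or> (kite I0 I1 l G \<cong>\<^sub>R kite {0 :: nat} {} empty_map G
        \<and> subdirectly_irreducible G)
     \<or> (\<exists>n\<ge>2. kite I0 I1 l G \<cong>\<^sub>R fin_kite n n (\<lambda>i. (i + 1) mod n) G)
     \<or> (\<exists>n\<ge>1. kite I0 I1 l G \<cong>\<^sub>R fin_kite (n + 1) n (\<lambda>i. i + 1) G)"
proof -
  interpret integral_residuated_lattice G by fact
  interpret kite_algebra I0 I1 l G
    using assms by unfold_locales
  show ?thesis
  proof (cases "I0 = {}")
    case True
    then have "K \<cong>\<^sub>R kite ({} :: nat set) {} empty_map G"
      using \<open>I1 \<subseteq> I0\<close> by (intro relabel_iso[where g = undefined]) (auto simp: bij_betw_def)
    with empty_kite_iso_Z_minus[OF assms(1)] show ?thesis by blast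
  next
    case False
    from connected_cycle_or_path[OF \<open>finite I0\<close> False
        subdirectly_irreducible_connected[OF assms(7,2)]]
    obtain N f where f: "bij_betw f {0..<Suc N} I0"
      and cases: "I1 = I0 \<and> (\<forall>k<Suc N. l (f k) = f ((k + 1) mod Suc N)) \<or>
        I1 = f ` {0..<N} \<and> (\<forall>k<N. l (f k) = f (k + 1))"
      by blast
    have base: "subdirectly_irreducible G" if "N = 0"
      using f that subdirectly_irreducible_base[OF assms(7,2), of "f 0"] by (simp add: bij_betw_def)
    from cases show ?thesis
    proof (elim disjE conjE)
      assume cycle: "I1 = I0" "\<forall>k<Suc N. l (f k) = f ((k + 1) mod Suc N)"
      \<comment> \<open>For \<open>N = 0\<close> the rotation of one point is the identity, which is the antilexicographic case.\<close>
      have "K \<cong>\<^sub>R fin_kite (Suc N) (Suc N) (\<lambda>i. (i + 1) mod Suc N) G"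
        using f cycle by (intro relabel_iso[where g = f]) (auto simp: bij_betw_def)
      moreover have "K \<cong>\<^sub>R kite {0 :: nat} {0} id G" if "N = 0"
        using f cycle that by (intro relabel_iso[where g = f]) (auto simp: bij_betw_def)
      ultimately show ?thesis
        using base singleton_kite_iso_antilex[OF assms(1), of "0 :: nat"] by (cases N) auto
    next
      assume path: "I1 = f ` {0..<N}" "\<forall>k<N. l (f k) = f (k + 1)"
      have "K \<cong>\<^sub>R fin_kite (N + 1) N (\<lambda>i. i + 1) G"
        using f path by (intro relabel_iso[where g = f]) auto
      moreover have "K \<cong>\<^sub>R kite {0 :: nat} {} empty_map G" if "N = 0"
        using f path that by (intro relabel_iso[where g = f]) auto
      ultimately show ?thesis
        using base by (cases N) auto
    qed
  qed
qed

end
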